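(* Let $\mathsf{XP}=\mathsf P\cup\mathcal X$ be an extended monodic temporal problem, where $\mathsf P=\langle\mathcal U,\mathcal I,\mathcal S,\mathcal E\rangle$ is a monodic temporal problem and $\mathcal X$ is its extended part, and let $\mathsf P'=\langle\mathcal U',\mathcal I',\mathcal S',\mathcal E'\rangle$ be the reduction of $\mathsf{XP}$ (defined in the context). Then $\mathsf{XP}$ is satisfiable if and only if $\mathsf P'$ is satisfiable.
   Context: First-order temporal logic (no function symbols, no equality; constants allowed), constant domains: a temporal structure is $\mathfrak M=\langle D,I\rangle$ with $D\ne\emptyset$ and first-order structures $\mathfrak M_n=\langle D,I_n\rangle$, $n\in\mathbb N$; constants are rigid (same interpretation at all $n$), predicates are flexible. $\bigcirc\phi$ holds at $n$ iff $\phi$ holds at $n+1$; $\Diamond\phi$ (resp. $\Box\phi$) holds at $n$ iff $\phi$ holds at some (resp. all) $m\ge n$. A formula is satisfiable if it holds at moment $0$ in some structure under some assignment. A monodic temporal problem is a quadruple $\mathsf P=\langle\mathcal U,\mathcal I,\mathcal S,\mathcal E\rangle$: $\mathcal U$ and $\mathcal I$ are finite sets of closed first-order formulae; $\mathcal S$ is a finite set of step clauses, ground $l\Rightarrow\bigcirc m$ ($l,m$ propositional literals) or non-ground $L(x)\Rightarrow\bigcirc M(x)$ ($L(x),M(x)$ unary literals), no two different ones with the same left-hand side; $\mathcal E$ is a finite set of eventuality clauses, ground $\Diamond l$ ($l$ a propositional literal) or non-ground $\Diamond L(x)$ ($L(x)$ a unary literal). It is identified with the formula $\mathcal I\wedge\Box\mathcal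 U\wedge\Box\forall x\,\mathcal S\wedge\Box\forall x\,\mathcal E$. An extended monodic temporal problem $\mathsf{XP}=\mathsf P\cup\mathcal X$ has in addition an extended part $\mathcal X$: a finite set of closed formulae built by Boolean connectives and quantifiers from temporal atoms $\bigcirc^iP(t_1,\dots,t_n)$, $i\ge0$, where $P(t_1,\dots,t_n)$ is a first-order atom ($P$ of arbitrary arity, $t_j$ variables or constants). It is identified with $\mathcal X\wedge\mathcal I\wedge\Box\mathcal U\wedge\Box\forall x\,\mathcal S\wedge\Box\forall x\,\mathcal E$; thus formulae of $\mathcal X$ are required to hold at moment $0$. Reduction. Let $k$ be the maximal $i$ such that some $\bigcirc^iP(t_1,\dots,t_n)$ occurs in $\mathcal X$. For every predicate $P$ occurring in $\mathsf{XP}$ introduce $k+1$ new predicates $P^0,\dots,P^k$ of the same arity. For a first-order formula $\phi$ in the language of $\mathsf{XP}$, $[\phi]^i$ denotes the result of replacing every predicate $P$ in $\phi$ by $P^i$. Put $\mathcal U'=\mathcal U$, $\mathcal S'=\mathcal S$, $\mathcal E'=\mathcal E$, and let $\mathcal I'$ consist exactly of: 1. $[\phi]^0$ for every $\phi\in\mathcal I$; 2. $\bigwedge_{i=0}^k[\phi]^i$ for every $\phi\in\mathcal U$; 3. $\bigwedge_{i=0}^{k-1}\forall x([L(x)]^i\Rightarrow[M(x)]^{i+1})$ for every $L(x)\Rightarrow\bigcirc M(x)\in\mathcal S$, and likewise $\bigwedge_{i=0}^{k-1}([l]^i\Rightarrow[m]^{i+1})$ for every ground $l\Rightarrow\bigcirc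 m\in\mathcal S$; 4. for every $\psi\in\mathcal X$, the formula obtained from $\psi$ by replacing every temporal atom $\bigcirc^iP(\bar t)$, $i\ge0$, by $P^i(\bar t)$; 5. $\forall x_1\dots\forall x_n(P(x_1,\dots,x_n)\equiv P^k(x_1,\dots,x_n))$ for every $n$-ary predicate $P$ in the language of $\mathsf{XP}$. *)

theory Defs
  imports Main
begin

section \<open>First-order temporal logic over the natural numbers\<close>

datatype 'c trm = Var nat | Const 'c

datatype ('p, 'c) fm =
    Atom 'p "'c trm list"
  | Bot
  | Neg "('p, 'c) fm"
  | Conj "('p, 'c) fm" "('p, 'c) fm"
  | Disj "('p, 'c) fm" "('p, 'c) fm"
  | Imp "('p, 'c) fm" "('p, 'c) fm"
  | Iff "('p, 'c) fm" "('p, 'c) fm"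
  | All nat "('p, 'c) fm"
  | Ex nat "('p, 'c) fm"
  | Next "('p, 'c) fm"
  | Sometime "('p, 'c) fm"
  | Always "('p, 'c) fm"

abbreviation Top :: "('p, 'c) fm" where
  "Top \<equiv> Neg Bot"

definition conj_list :: "('p, 'c) fm list \<Rightarrow> ('p, 'c) fm" where
  "conj_list \<phi>s = foldr Conj \<phi>s Top"

text \<open>The conjunction of a finite set of formulae, taken in an arbitrary order.\<close>

definition conj_set :: "('p, 'c) fm set \<Rightarrow> ('p, 'c) fm" where
  "conj_set \<Phi> = conj_list (SOME \<phi>s. distinct \<phi>s \<and> set \<phi>s = \<Phi>)"

fun tvars :: "'c trm \<Rightarrow> nat set" where
  "tvars (Var x) = {x}"
| "tvars (Const c) = {}"

fun fvars :: "('p, 'c) fm \<Rightarrow> nat set" where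
  "fvars (Atom P ts) = (\<Union>t\<in>set ts. tvars t)"
| "fvars Bot = {}"
| "fvars (Neg \<phi>) = fvars \<phi>"
| "fvars (Conj \<phi> \<psi>) = fvars \<phi> \<union> fvars \<psi>"
| "fvars (Disj \<phi> \<psi>) = fvars \<phi> \<union> fvars \<psi>"
| "fvars (Imp \<phi> \<psi>) = fvars \<phi> \<union> fvars \<psi>"
| "fvars (Iff \<phi> \<psi>) = fvars \<phi> \<union> fvars \<psi>"
| "fvars (All x \<phi>) = fvars \<phi> - {x}"
| "fvars (Ex x \<phi>) = fvars \<phi> - {x}"
| "fvars (Next \<phi>) = fvars \<phi>"
| "fvars (Sometime \<phi>) = fvars \<phi>"
| "fvars (Always \<phi>) = fvars \<phi>"

definition closed_fm :: "('p, 'c) fm \<Rightarrow> bool" where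
  "closed_fm \<phi> \<longleftrightarrow> fvars \<phi> = {}"

fun subfms :: "('p, 'c) fm \<Rightarrow> ('p, 'c) fm set" where
  "subfms (Atom P ts) = {Atom P ts}"
| "subfms Bot = {Bot}"
| "subfms (Neg \<phi>) = insert (Neg \<phi>) (subfms \<phi>)"
| "subfms (Conj \<phi> \<psi>) = insert (Conj \<phi> \<psi>) (subfms \<phi> \<union> subfms \<psi>)"
| "subfms (Disj \<phi> \<psi>) = insert (Disj \<phi> \<psi>) (subfms \<phi> \<union> subfms \<psi>)"
| "subfms (Imp \<phi> \<psi>) = insert (Imp \<phi> \<psi>) (subfms \<phi> \<union> subfms \<psi>)"
| "subfms (Iff \<phi> \<psi>) = insert (Iff \<phi> \<psi>) (subfms \<phi> \<union> subfms \<psi>)"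
| "subfms (All x \<phi>) = insert (All x \<phi>) (subfms \<phi>)"
| "subfms (Ex x \<phi>) = insert (Ex x \<phi>) (subfms \<phi>)"
| "subfms (Next \<phi>) = insert (Next \<phi>) (subfms \<phi>)"
| "subfms (Sometime \<phi>) = insert (Sometime \<phi>) (subfms \<phi>)"
| "subfms (Always \<phi>) = insert (Always \<phi>) (subfms \<phi>)"

text \<open>The signature is given by an arity function on the predicate symbols.\<close>

definition wf_fm :: "('p \<Rightarrow> nat) \<Rightarrow> ('p, 'c) fm \<Rightarrow> bool" where
  "wf_fm ar \<phi> \<longleftrightarrow> (\<forall>P ts. Atom P ts \<in> subfms \<phi> \<longrightarrow> length ts = ar P)"

inductive first_order :: "('p, 'c) fm \<Rightarrow> bool" where
  "first_order (Atom P ts)"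
| "first_order Bot"
| "first_order \<phi> \<Longrightarrow> first_order (Neg \<phi>)"
| "first_order \<phi> \<Longrightarrow> first_order \<psi> \<Longrightarrow> first_order (Conj \<phi> \<psi>)"
| "first_order \<phi> \<Longrightarrow> first_order \<psi> \<Longrightarrow> first_order (Disj \<phi> \<psi>)"
| "first_order \<phi> \<Longrightarrow> first_order \<psi> \<Longrightarrow> first_order (Imp \<phi> \<psi>)"
| "first_order \<phi> \<Longrightarrow> first_order \<psi> \<Longrightarrow> first_order (Iff \<phi> \<psi>)"
| "first_order \<phi> \<Longrightarrow> first_order (All x \<phi>)"
| "first_order \<phi> \<Longrightarrow> first_order (Ex x \<phi>)"

abbreviation tatom :: "nat \<Rightarrow> 'p \<Rightarrow> 'c trm list \<Rightarrow> ('p, 'c) fm" where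
  "tatom i P ts \<equiv> (Next ^^ i) (Atom P ts)"

inductive extended :: "('p, 'c) fm \<Rightarrow> bool" where
  "extended (tatom i P ts)"
| "extended Bot"
| "extended \<phi> \<Longrightarrow> extended (Neg \<phi>)"
| "extended \<phi> \<Longrightarrow> extended \<psi> \<Longrightarrow> extended (Conj \<phi> \<psi>)"
| "extended \<phi> \<Longrightarrow> extended \<psi> \<Longrightarrow> extended (Disj \<phi> \<psi>)"
| "extended \<phi> \<Longrightarrow> extended \<psi> \<Longrightarrow> extended (Imp \<phi> \<psi>)"
| "extended \<phi> \<Longrightarrow> extended \<psi> \<Longrightarrow> extended (Iff \<phi> \<psi>)"
| "extended \<phi> \<Longrightarrow> extended (All x \<phi>)"
| "extended \<phi> \<Longrightarrow> extended (Ex x \<phi>)"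


section \<open>Semantics\<close>

text \<open>Constant domain, rigid constants, flexible predicates.  An \<open>n\<close>-ary relation is a set of
  lists of length \<open>n\<close>; a propositional letter is true iff its interpretation contains \<open>[]\<close>.\<close>

record ('p, 'c, 'd) tstruct =
  Dom :: "'d set"
  cint :: "'c \<Rightarrow> 'd"
  pint :: "nat \<Rightarrow> 'p \<Rightarrow> 'd list set"

definition temporal_structure :: "('p \<Rightarrow> nat) \<Rightarrow> ('p, 'c, 'd) tstruct \<Rightarrow> bool" where
  "temporal_structure ar M \<longleftrightarrow>
     Dom M \<noteq> {} \<and> (\<forall>c. cint M c \<in> Dom M) \<and>
     (\<forall>n P. pint M n P \<subseteq> {ds. length ds = ar P \<and> set ds \<subseteq> Dom M})"

fun tval :: "('p, 'c, 'd) tstruct \<Rightarrow> (nat \<Rightarrow> 'd) \<Rightarrow> 'c trm \<Rightarrow> 'd" where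
  "tval M a (Var x) = a x"
| "tval M a (Const c) = cint M c"

fun sat :: "('p, 'c, 'd) tstruct \<Rightarrow> nat \<Rightarrow> (nat \<Rightarrow> 'd) \<Rightarrow> ('p, 'c) fm \<Rightarrow> bool" where
  "sat M n a (Atom P ts) \<longleftrightarrow> map (tval M a) ts \<in> pint M n P"
| "sat M n a Bot \<longleftrightarrow> False"
| "sat M n a (Neg \<phi>) \<longleftrightarrow> \<not> sat M n a \<phi>"
| "sat M n a (Conj \<phi> \<psi>) \<longleftrightarrow> sat M n a \<phi> \<and> sat M n a \<psi>"
| "sat M n a (Disj \<phi> \<psi>) \<longleftrightarrow> sat M n a \<phi> \<or> sat M n a \<psi>"
| "sat M n a (Imp \<phi> \<psi>) \<longleftrightarrow> (sat M n a \<phi> \<longrightarrow> sat M n a \<psi>)"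
| "sat M n a (Iff \<phi> \<psi>) \<longleftrightarrow> (sat M n a \<phi> \<longleftrightarrow> sat M n a \<psi>)"
| "sat M n a (All x \<phi>) \<longleftrightarrow> (\<forall>d\<in>Dom M. sat M n (a(x := d)) \<phi>)"
| "sat M n a (Ex x \<phi>) \<longleftrightarrow> (\<exists>d\<in>Dom M. sat M n (a(x := d)) \<phi>)"
| "sat M n a (Next \<phi>) \<longleftrightarrow> sat M (Suc n) a \<phi>"
| "sat M n a (Sometime \<phi>) \<longleftrightarrow> (\<exists>m\<ge>n. sat M m a \<phi>)"
| "sat M n a (Always \<phi>) \<longleftrightarrow> (\<forall>m\<ge>n. sat M m a \<phi>)"

text \<open>Satisfiability in a structure whose domain is an arbitrary nonempty subset of the type
  \<open>'d\<close>.  HOL cannot quantify over types inside a formula, hence the type argument; statements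
  that are polymorphic in \<open>'d\<close> cover domains of every size.\<close>

definition satisfiable :: "('p \<Rightarrow> nat) \<Rightarrow> 'd itself \<Rightarrow> ('p, 'c) fm \<Rightarrow> bool" where
  "satisfiable ar (_ :: 'd itself) \<phi> \<longleftrightarrow>
     (\<exists>(M :: ('p, 'c, 'd) tstruct) a.
        temporal_structure ar M \<and> range a \<subseteq> Dom M \<and> sat M 0 a \<phi>)"

lemma sat_conj_list: "sat M n a (conj_list \<phi>s) \<longleftrightarrow> (\<forall>\<phi>\<in>set \<phi>s. sat M n a \<phi>)"
  by (induction \<phi>s) (auto simp: conj_list_def)

lemma sat_conj_set:
  assumes "finite \<Phi>"
  shows "sat M n a (conj_set \<Phi>) \<longleftrightarrow> (\<forall>\<phi>\<in>\<Phi>. sat M n a \<phi>)"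
proof -
  have "set (SOME \<phi>s. distinct \<phi>s \<and> set \<phi>s = \<Phi>) = \<Phi>"
    by (rule someI2_ex) (use finite_distinct_list[OF assms] in auto)
  then show ?thesis
    by (simp add: conj_set_def sat_conj_list)
qed


section \<open>Monodic temporal problems\<close>

datatype 'p lit = PosL 'p | NegL 'p

fun lit_pred :: "'p lit \<Rightarrow> 'p" where
  "lit_pred (PosL P) = P"
| "lit_pred (NegL P) = P"

fun lit_fm :: "'c trm list \<Rightarrow> 'p lit \<Rightarrow> ('p, 'c) fm" where
  "lit_fm ts (PosL P) = Atom P ts"
| "lit_fm ts (NegL P) = Neg (Atom P ts)"

text \<open>All non-ground clauses are written over one fixed variable \<open>x\<close>, here variable \<open>0\<close>.\<close>

abbreviation ground_lit :: "'p lit \<Rightarrow> ('p, 'c) fm" where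
  "ground_lit \<equiv> lit_fm []"

abbreviation unary_lit :: "'p lit \<Rightarrow> ('p, 'c) fm" where
  "unary_lit \<equiv> lit_fm [Var 0]"

datatype 'p step_clause = GroundStep "'p lit" "'p lit" | UnaryStep "'p lit" "'p lit"

datatype 'p evt_clause = GroundEvt "'p lit" | UnaryEvt "'p lit"

fun step_lhs :: "'p step_clause \<Rightarrow> ('p, 'c) fm" where
  "step_lhs (GroundStep l m) = ground_lit l"
| "step_lhs (UnaryStep L M) = unary_lit L"

fun step_fm :: "'p step_clause \<Rightarrow> ('p, 'c) fm" where
  "step_fm (GroundStep l m) = Imp (ground_lit l) (Next (ground_lit m))"
| "step_fm (UnaryStep L M) = Imp (unary_lit L) (Next (unary_lit M))"

fun evt_fm :: "'p evt_clause \<Rightarrow> ('p, 'c) fm" where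
  "evt_fm (GroundEvt l) = Sometime (ground_lit l)"
| "evt_fm (UnaryEvt L) = Sometime (unary_lit L)"

record ('p, 'c) problem =
  univ_part :: "('p, 'c) fm set"
  init_part :: "('p, 'c) fm set"
  step_part :: "'p step_clause set"
  evt_part :: "'p evt_clause set"

definition monodic_problem :: "('p \<Rightarrow> nat) \<Rightarrow> ('p, 'c) problem \<Rightarrow> bool" where
  "monodic_problem ar \<P> \<longleftrightarrow>
     finite (univ_part \<P>) \<and> finite (init_part \<P>) \<and>
     finite (step_part \<P>) \<and> finite (evt_part \<P>) \<and>
     (\<forall>\<phi>\<in>univ_part \<P> \<union> init_part \<P>. first_order \<phi> \<and> closed_fm \<phi> \<and> wf_fm ar \<phi>) \<and>
     (\<forall>s\<in>step_part \<P>. wf_fm ar (step_fm s :: ('p, 'c) fm)) \<and>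
     (\<forall>s\<in>step_part \<P>. \<forall>s'\<in>step_part \<P>.
        (step_lhs s :: ('p, 'c) fm) = step_lhs s' \<longrightarrow> s = s') \<and>
     (\<forall>e\<in>evt_part \<P>. wf_fm ar (evt_fm e :: ('p, 'c) fm))"

definition problem_fm :: "('p, 'c) problem \<Rightarrow> ('p, 'c) fm" where
  "problem_fm \<P> =
     Conj (conj_set (init_part \<P>))
    (Conj (Always (conj_set (univ_part \<P>)))
    (Conj (Always (All 0 (conj_set (step_fm ` step_part \<P>))))
          (Always (All 0 (conj_set (evt_fm ` evt_part \<P>))))))"

definition extended_part :: "('p \<Rightarrow> nat) \<Rightarrow> ('p, 'c) fm set \<Rightarrow> bool" where
  "extended_part ar \<X> \<longleftrightarrow>
     finite \<X> \<and> (\<forall>\<psi>\<in>\<X>. extended \<psi> \<and> closed_fm \<psi> \<and> wf_fm ar \<psi>)"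

text \<open>The extended problem consisting of \<open>\<P>\<close> and the extended part \<open>\<X>\<close>.\<close>

definition ext_problem_fm :: "('p, 'c) problem \<Rightarrow> ('p, 'c) fm set \<Rightarrow> ('p, 'c) fm" where
  "ext_problem_fm \<P> \<X> = Conj (conj_set \<X>) (problem_fm \<P>)"

text \<open>The predicates occurring in the extended problem; the BNF function \<open>set1_fm\<close> collects
  the predicates of a formula.\<close>

definition language :: "('p, 'c) problem \<Rightarrow> ('p, 'c) fm set \<Rightarrow> 'p set" where
  "language \<P> \<X> =
     (\<Union>\<phi> \<in> univ_part \<P> \<union> init_part \<P> \<union> step_fm ` step_part \<P> \<union> evt_fm ` evt_part \<P> \<union> \<X>.
        set1_fm \<phi>)"


section \<open>The reduction\<close>

text \<open>The \<open>0\<close> only matters if no temporal atom occurs in \<open>\<X>\<close>; then \<open>k\<close> is taken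
  to be \<open>0\<close>.\<close>

definition max_next :: "('p, 'c) fm set \<Rightarrow> nat" where
  "max_next \<X> = Max (insert 0 {i. \<exists>\<psi>\<in>\<X>. \<exists>P ts. tatom i P ts \<in> subfms \<psi>})"

text \<open>\<open>cp P i\<close> is the new predicate \<open>P\<^sup>i\<close>.\<close>

definition fresh_copies ::
  "('p \<Rightarrow> nat) \<Rightarrow> ('p, 'c) problem \<Rightarrow> ('p, 'c) fm set \<Rightarrow> ('p \<Rightarrow> nat \<Rightarrow> 'p) \<Rightarrow> bool" where
  "fresh_copies ar \<P> \<X> cp \<longleftrightarrow>
     inj_on (\<lambda>(P, i). cp P i) (language \<P> \<X> \<times> {..max_next \<X>}) \<and>
     (\<forall>P\<in>language \<P> \<X>. \<forall>i\<le>max_next \<X>. cp P i \<notin> language \<P> \<X> \<and> ar (cp P i) = ar P)"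

text \<open>\<open>[\<phi>]\<^sup>i\<close>\<close>

definition copy_fm :: "('p \<Rightarrow> nat \<Rightarrow> 'p) \<Rightarrow> nat \<Rightarrow> ('p, 'c) fm \<Rightarrow> ('p, 'c) fm" where
  "copy_fm cp i = map_fm (\<lambda>P. cp P i) id"

text \<open>Replaces every temporal atom \<open>tatom j P ts\<close> by \<open>Atom (cp P j) ts\<close>, where the first
  numeric argument counts the \<open>Next\<close> operators already passed.  Only the behaviour on
  formulae satisfying \<open>extended\<close> matters.\<close>

fun flatten :: "('p \<Rightarrow> nat \<Rightarrow> 'p) \<Rightarrow> nat \<Rightarrow> ('p, 'c) fm \<Rightarrow> ('p, 'c) fm" where
  "flatten cp i (Atom P ts) = Atom (cp P i) ts"
| "flatten cp i Bot = Bot"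
| "flatten cp i (Neg \<phi>) = Neg (flatten cp i \<phi>)"
| "flatten cp i (Conj \<phi> \<psi>) = Conj (flatten cp i \<phi>) (flatten cp i \<psi>)"
| "flatten cp i (Disj \<phi> \<psi>) = Disj (flatten cp i \<phi>) (flatten cp i \<psi>)"
| "flatten cp i (Imp \<phi> \<psi>) = Imp (flatten cp i \<phi>) (flatten cp i \<psi>)"
| "flatten cp i (Iff \<phi> \<psi>) = Iff (flatten cp i \<phi>) (flatten cp i \<psi>)"
| "flatten cp i (All x \<phi>) = All x (flatten cp i \<phi>)"
| "flatten cp i (Ex x \<phi>) = Ex x (flatten cp i \<phi>)"
| "flatten cp i (Next \<phi>) = flatten cp (Suc i) \<phi>"
| "flatten cp i (Sometime \<phi>) = Sometime (flatten cp i \<phi>)"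
| "flatten cp i (Always \<phi>) = Always (flatten cp i \<phi>)"

lemma flatten_tatom: "flatten cp j (tatom i P ts) = Atom (cp P (j + i)) ts"
  by (induction i arbitrary: j) auto

fun step_copies :: "('p \<Rightarrow> nat \<Rightarrow> 'p) \<Rightarrow> nat \<Rightarrow> 'p step_clause \<Rightarrow> ('p, 'c) fm" where
  "step_copies cp k (GroundStep l m) =
     conj_list (map (\<lambda>i. Imp (copy_fm cp i (ground_lit l)) (copy_fm cp (i + 1) (ground_lit m)))
       [0..<k])"
| "step_copies cp k (UnaryStep L M) =
     conj_list (map (\<lambda>i. All 0 (Imp (copy_fm cp i (unary_lit L)) (copy_fm cp (i + 1) (unary_lit M))))
       [0..<k])"

definition pred_equiv :: "('p \<Rightarrow> nat) \<Rightarrow> 'p \<Rightarrow> 'p \<Rightarrow> ('p, 'c) fm" where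
  "pred_equiv ar P Q =
     foldr All [0..<ar P] (Iff (Atom P (map Var [0..<ar P])) (Atom Q (map Var [0..<ar P])))"

definition reduction ::
  "('p \<Rightarrow> nat) \<Rightarrow> ('p \<Rightarrow> nat \<Rightarrow> 'p) \<Rightarrow> ('p, 'c) problem \<Rightarrow> ('p, 'c) fm set \<Rightarrow> ('p, 'c) problem" where
  "reduction ar cp \<P> \<X> =
     (let k = max_next \<X> in
      \<lparr> univ_part = univ_part \<P>,
        init_part =
          copy_fm cp 0 ` init_part \<P> \<union>
          (\<lambda>\<phi>. conj_list (map (\<lambda>i. copy_fm cp i \<phi>) [0..<k + 1])) ` univ_part \<P> \<union>
          step_copies cp k ` step_part \<P> \<union>
          flatten cp 0 ` \<X> \<union>
          (\<lambda>P. pred_equiv ar P (cp P k)) ` language \<P> \<X>,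
        step_part = step_part \<P>,
        evt_part = evt_part \<P> \<rparr>)"

end

theory Submission
  imports Defs
begin

text \<open>The first \<open>k\<close> moments of a model of the extended problem are stored in the copies \<open>P\<^sup>i\<close> at
  moment \<open>0\<close> of a model of the reduction, and the later moments, shifted by \<open>k\<close>, form the model of
  the reduction itself; moment \<open>k\<close> is represented twice, and the equivalences of \<open>P\<close> with \<open>P\<^sup>k\<close>
  glue the two parts together.  Two structures related in this way satisfy the two problems
  simultaneously (\<open>sat_reduction_iff\<close>), because an eventuality that holds at moment \<open>k\<close>
  holds at all earlier moments.\<close>

section \<open>Truth of iterated quantifiers and of predicate equivalences\<close>

text \<open>Successive updates of \<open>a\<close> at the variables of \<open>xs\<close> reach
  exactly the assignments that agree with \<open>a\<close> off \<open>xs\<close> and take values in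
  the domain on \<open>xs\<close>. So an iterated quantifier can be instantiated with a whole tuple
  at once.\<close>

lemma sat_foldr_All:
  "sat M n a (foldr All xs \<phi>) \<longleftrightarrow>
     (\<forall>b. (\<forall>x\<in>set xs. b x \<in> Dom M) \<longrightarrow> (\<forall>x. x \<notin> set xs \<longrightarrow> b x = a x) \<longrightarrow> sat M n b \<phi>)"
proof (induction xs arbitrary: a)
  case Nil
  then show ?case by (simp flip: fun_eq_iff)
next
  case (Cons x xs)
  show ?case
  proof
    assume L: "sat M n a (foldr All (x # xs) \<phi>)"
    show "\<forall>b. (\<forall>y\<in>set (x # xs). b y \<in> Dom M) \<longrightarrow>
        (\<forall>y. y \<notin> set (x # xs) \<longrightarrow> b y = a y) \<longrightarrow> sat M n b \<phi>"
    proof (intro allI impI)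
      fix b
      assume b: "\<forall>y\<in>set (x # xs). b y \<in> Dom M" "\<forall>y. y \<notin> set (x # xs) \<longrightarrow> b y = a y"
      then have "sat M n (a(x := b x)) (foldr All xs \<phi>)"
        using L by simp
      then show "sat M n b \<phi>"
        using b by (simp add: Cons.IH)
    qed
  next
    assume R: "\<forall>b. (\<forall>y\<in>set (x # xs). b y \<in> Dom M) \<longrightarrow>
        (\<forall>y. y \<notin> set (x # xs) \<longrightarrow> b y = a y) \<longrightarrow> sat M n b \<phi>"
    have "sat M n b \<phi>"
      if d: "d \<in> Dom M" and b: "\<forall>y\<in>set xs. b y \<in> Dom M"
        "\<forall>y. y \<notin> set xs \<longrightarrow> b y = (a(x := d)) y" for d b
    proof -
      \<comment> \<open>A variable repeated in \<open>xs\<close> gets its final value from a later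
        quantifier, hence the case split.\<close>
      have "b x \<in> Dom M"
        using d b by (cases "x \<in> set xs") auto
      then show ?thesis
        using R b by simp
    qed
    then show "sat M n a (foldr All (x # xs) \<phi>)"
      by (simp add: Cons.IH)
  qed
qed

text \<open>The formula compares the two relations only on tuples of length \<open>ar P\<close> over
  the domain; once the arities agree, relations of a temporal structure contain nothing
  else.\<close>

lemma sat_pred_equiv:
  assumes "temporal_structure ar M" and "ar Q = ar P"
  shows "sat M n a (pred_equiv ar P Q) \<longleftrightarrow> pint M n P = pint M n Q"
proof
  assume S: "sat M n a (pred_equiv ar P Q)"
  have eq: "ds \<in> pint M n P \<longleftrightarrow> ds \<in> pint M n Q"
    if ds: "length ds = ar P" "set ds \<subseteq> Dom M" for ds
  proof -
    \<comment> \<open>\<open>b\<close> reads the tuple \<open>ds\<close> into the variables below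
      \<open>ar P\<close>, so the argument list of both atoms evaluates to
      \<open>ds\<close>.\<close>
    define b where "b = (\<lambda>i. if i < ar P then ds ! i else a i)"
    have "map b [0..<ar P] = ds"
      using ds by (intro nth_equalityI) (auto simp: b_def)
    moreover have "\<forall>x\<in>set [0..<ar P]. b x \<in> Dom M" "\<forall>x. x \<notin> set [0..<ar P] \<longrightarrow> b x = a x"
      using ds by (auto simp: b_def)
    ultimately show ?thesis
      using S unfolding pred_equiv_def sat_foldr_All by (force simp: comp_def)
  qed
  have "pint M n P \<subseteq> {ds. length ds = ar P \<and> set ds \<subseteq> Dom M}"
    "pint M n Q \<subseteq> {ds. length ds = ar P \<and> set ds \<subseteq> Dom M}"
    using assms unfolding temporal_structure_def by metis+
  with eq show "pint M n P = pint M n Q" by blast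
next
  assume "pint M n P = pint M n Q"
  then show "sat M n a (pred_equiv ar P Q)"
    by (simp add: pred_equiv_def sat_foldr_All)
qed

section \<open>Temporal atoms and the bound on their indices\<close>

lemma sat_tatom: "sat M n a (tatom i P ts) \<longleftrightarrow> map (tval M a) ts \<in> pint M (n + i) P"
  by (induction i arbitrary: n) auto

lemma subfms_refl: "\<phi> \<in> subfms \<phi>"
  by (cases \<phi>) auto

lemma finite_set1_fm: "finite (set1_fm \<phi>)"
  by (induction \<phi>) auto

lemma set1_fm_subfms: "\<psi> \<in> subfms \<phi> \<Longrightarrow> set1_fm \<psi> \<subseteq> set1_fm \<phi>"
  by (induction \<phi>) auto

lemma set1_fm_tatom: "set1_fm (tatom i P ts) = {P}"
  by (induction i) auto

lemma size_tatom: "i \<le> size (tatom i P ts)"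
  by (induction i) auto

lemma size_subfms: "\<psi> \<in> subfms \<phi> \<Longrightarrow> size \<psi> \<le> size \<phi>"
  by (induction \<phi>) fastforce+

text \<open>\<open>max_next\<close> is a maximum, so its index set must be finite: an atom under
  \<open>i\<close> nested \<open>Next\<close> has size at least \<open>i\<close>, and subformulae
  are no larger than the formula.\<close>

lemma finite_tatom_indices:
  assumes "finite \<Phi>"
  shows "finite {i. \<exists>\<psi>\<in>\<Phi>. \<exists>P ts. tatom i P ts \<in> subfms \<psi>}"
proof (rule finite_subset)
  show "{i. \<exists>\<psi>\<in>\<Phi>. \<exists>P ts. tatom i P ts \<in> subfms \<psi>} \<subseteq> (\<Union>\<psi>\<in>\<Phi>. {..size \<psi>})"
    by (auto intro: order_trans[OF size_tatom size_subfms])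
qed (use assms in simp)

lemma tatom_le_max_next:
  assumes "finite \<X>" and "\<psi> \<in> \<X>" and "tatom i P ts \<in> subfms \<psi>"
  shows "i \<le> max_next \<X>"
  unfolding max_next_def
  using finite_tatom_indices[OF assms(1)] assms(2,3) by (intro Max_ge) auto

section \<open>Renaming predicates and flattening temporal atoms\<close>

lemma first_order_lit_fm: "first_order (lit_fm ts l)"
  by (cases l) (auto intro: first_order.intros)

text \<open>Common core of the time shift (identity renaming) and of the copies (\<open>f\<close>
  sends \<open>P\<close> to \<open>cp P i\<close>). First-order formulae look at a single moment, so
  agreement of the relations at moments \<open>n\<close> and \<open>m\<close> suffices.\<close>

lemma sat_map_fm:
  assumes "first_order \<phi>" and "Dom N = Dom M" and "cint N = cint M"
    and "\<And>P. P \<in> set1_fm \<phi> \<Longrightarrow> pint N n (f P) = pint M m P"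
  shows "sat N n a (map_fm f id \<phi>) \<longleftrightarrow> sat M m a \<phi>"
proof -
  have tval: "tval N b (map_trm id t) = tval M b t" for b t
    using assms(3) by (cases t) auto
  show ?thesis
    using assms(1,4)
    by (induction arbitrary: a) (simp_all add: assms(2) tval comp_def)
qed

text \<open>Induction on \<open>extended\<close> reaches a temporal atom as a whole, so the counter
  of \<open>flatten\<close> is still \<open>0\<close> there and \<open>flatten_tatom\<close> gives
  the index \<open>i\<close>.\<close>

lemma sat_flatten:
  assumes "extended \<psi>" and "Dom N = Dom M" and "cint N = cint M"
    and "\<And>i P ts. tatom i P ts \<in> subfms \<psi> \<Longrightarrow> pint N n (cp P i) = pint M (m + i) P"
  shows "sat N n a (flatten cp 0 \<psi>) \<longleftrightarrow> sat M m a \<psi>"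
proof -
  have tval: "tval N b = tval M b" for b
  proof
    show "tval N b t = tval M b t" for t
      using assms(3) by (cases t) auto
  qed
  \<comment> \<open>The assumption on indices refers to the fixed \<open>\<psi>\<close>, hence the
    induction over formulae whose subformulae all belong to \<open>\<psi>\<close>.\<close>
  have "sat N n a (flatten cp 0 \<phi>) \<longleftrightarrow> sat M m a \<phi>"
    if "extended \<phi>" and "subfms \<phi> \<subseteq> subfms \<psi>" for \<phi>
    using that
  proof (induction arbitrary: a)
    case (1 i P ts)
    with subfms_refl have "tatom i P ts \<in> subfms \<psi>" by blast
    from assms(4)[OF this] show ?case
      by (simp add: flatten_tatom sat_tatom tval)
  qed (simp_all add: assms(2))
  then show ?thesis
    using assms(1) by simp
qed

section \<open>Truth of problems and its transfer between related structures\<close>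

lemma sat_problem_fm:
  assumes "finite (univ_part \<P>)" "finite (init_part \<P>)" "finite (step_part \<P>)" "finite (evt_part \<P>)"
  shows "sat M 0 a (problem_fm \<P>) \<longleftrightarrow>
     (\<forall>\<phi>\<in>init_part \<P>. sat M 0 a \<phi>) \<and>
     (\<forall>n. \<forall>\<phi>\<in>univ_part \<P>. sat M n a \<phi>) \<and>
     (\<forall>n. \<forall>d\<in>Dom M. \<forall>s\<in>step_part \<P>. sat M n (a(0 := d)) (step_fm s)) \<and>
     (\<forall>n. \<forall>d\<in>Dom M. \<forall>e\<in>evt_part \<P>. sat M n (a(0 := d)) (evt_fm e))"
  using assms by (simp add: problem_fm_def sat_conj_set)

text \<open>\<open>M\<close> is meant to be a model of the extended problem and \<open>N\<close> one of the reduction.\<close>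

definition unfolds ::
  "'p set \<Rightarrow> ('p \<Rightarrow> nat \<Rightarrow> 'p) \<Rightarrow> nat \<Rightarrow> ('p, 'c, 'd) tstruct \<Rightarrow> ('p, 'c, 'd) tstruct \<Rightarrow> bool" where
  "unfolds L cp k M N \<longleftrightarrow> Dom N = Dom M \<and> cint N = cint M \<and>
     (\<forall>P\<in>L. \<forall>n. pint N n P = pint M (n + k) P) \<and>
     (\<forall>P\<in>L. \<forall>i\<le>k. pint N 0 (cp P i) = pint M i P)"

lemma sat_shift:
  assumes "unfolds L cp k M N" and "first_order \<phi>" and "set1_fm \<phi> \<subseteq> L"
  shows "sat N n a \<phi> \<longleftrightarrow> sat M (n + k) a \<phi>"
proof -
  have "sat N n a (map_fm id id \<phi>) \<longleftrightarrow> sat M (n + k) a \<phi>"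
    using assms by (intro sat_map_fm) (auto simp: unfolds_def)
  then show ?thesis
    by (simp add: fm.map_id)
qed

lemma sat_copy_fm:
  assumes "unfolds L cp k M N" and "first_order \<phi>" and "set1_fm \<phi> \<subseteq> L" and "i \<le> k"
  shows "sat N 0 a (copy_fm cp i \<phi>) \<longleftrightarrow> sat M i a \<phi>"
  unfolding copy_fm_def using assms by (intro sat_map_fm) (auto simp: unfolds_def)

lemma sat_step_fm_shift:
  fixes M N :: "('p, 'c, 'd) tstruct"
  assumes "unfolds L cp k M N" and "set1_fm (step_fm s :: ('p, 'c) fm) \<subseteq> L"
  shows "sat N n a (step_fm s) \<longleftrightarrow> sat M (n + k) a (step_fm s)"
  using assms(2)
  by (cases s) (simp_all add: sat_shift[OF assms(1) first_order_lit_fm])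

lemma sat_evt_fm_shift:
  fixes M N :: "('p, 'c, 'd) tstruct"
  assumes "unfolds L cp k M N" and "set1_fm (evt_fm e :: ('p, 'c) fm) \<subseteq> L"
  shows "sat N n a (evt_fm e) \<longleftrightarrow> sat M (n + k) a (evt_fm e)"
proof -
  \<comment> \<open>Translation by \<open>k\<close> maps the moments from \<open>n\<close> on
    bijectively to those from \<open>n + k\<close> on.\<close>
  have ex: "(\<exists>m\<ge>n + k. Q m) \<longleftrightarrow> (\<exists>m\<ge>n. Q (m + k))" for Q
    by (metis add_le_cancel_right le_add_diff_inverse2 add_leD2)
  show ?thesis
    using assms(2)
    by (cases e) (simp_all add: sat_shift[OF assms(1) first_order_lit_fm] ex)
qed

text \<open>The clause at moment \<open>i\<close> concerns moments \<open>i\<close> and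
  \<open>i + 1\<close>, both represented by copies exactly when \<open>i < k\<close>.\<close>

lemma sat_step_copies:
  fixes M N :: "('p, 'c, 'd) tstruct"
  assumes "unfolds L cp k M N" and "set1_fm (step_fm s :: ('p, 'c) fm) \<subseteq> L" and "Dom M \<noteq> {}"
  shows "sat N 0 a (step_copies cp k s) \<longleftrightarrow>
     (\<forall>i<k. \<forall>d\<in>Dom M. sat M i (a(0 := d)) (step_fm s))"
proof (cases s)
  case (GroundStep l m)
  have ground: "sat M i b (ground_lit l') \<longleftrightarrow> sat M i a (ground_lit l')" for i b l'
    by (cases l') auto
  show ?thesis
    using assms(2,3) GroundStep
    by (auto simp: sat_conj_list sat_copy_fm[OF assms(1) first_order_lit_fm] ground[of _ "a(0 := _)"])
next
  case (UnaryStep l m)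
  then show ?thesis
    using assms(1,2)
    by (auto simp: sat_conj_list sat_copy_fm[OF assms(1) first_order_lit_fm] unfolds_def)
qed

text \<open>Moments below \<open>k\<close> are stored in the copies, moments from \<open>k\<close>
  on in the shifted structure; this splits an always-condition accordingly.\<close>

lemma all_nat_split: "(\<forall>n. Q n) \<longleftrightarrow> (\<forall>i<k. Q i) \<and> (\<forall>n::nat. Q (n + k))"
  by (metis le_add_diff_inverse2 not_less)

text \<open>A witness at or after \<open>m\<close> also lies at or after \<open>n\<close>. This
  carries eventualities back to the moments before \<open>k\<close>, for which the reduction states
  none.\<close>

lemma sat_evt_fm_antimono: "sat M m a (evt_fm e) \<Longrightarrow> n \<le> m \<Longrightarrow> sat M n a (evt_fm e)"
  by (cases e) (auto intro: order_trans)

section \<open>The reduction in a pair of related structures\<close>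

text \<open>\<open>conj_set\<close> is meaningful on finite sets only, and the reduction adds one
  equivalence to the initial part for each predicate of the language.\<close>

lemma finite_language:
  assumes "monodic_problem ar \<P>" and "extended_part ar \<X>"
  shows "finite (language \<P> \<X>)"
  using assms by (auto simp: language_def monodic_problem_def extended_part_def finite_set1_fm)

text \<open>Stated for a single structure \<open>N\<close>, so that the equivalences can be read off
  before any related \<open>M\<close> is at hand.\<close>

lemma sat_problem_fm_reduction:
  assumes "monodic_problem ar \<P>" and "extended_part ar \<X>"
  shows "sat N 0 a (problem_fm (reduction ar cp \<P> \<X>)) \<longleftrightarrow>
     (\<forall>\<phi>\<in>init_part \<P>. sat N 0 a (copy_fm cp 0 \<phi>)) \<and>
     (\<forall>\<phi>\<in>univ_part \<P>. \<forall>i\<le>max_next \<X>. sat N 0 a (copy_fm cp i \<phi>)) \<and>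
     (\<forall>s\<in>step_part \<P>. sat N 0 a (step_copies cp (max_next \<X>) s)) \<and>
     (\<forall>\<psi>\<in>\<X>. sat N 0 a (flatten cp 0 \<psi>)) \<and>
     (\<forall>P\<in>language \<P> \<X>. sat N 0 a (pred_equiv ar P (cp P (max_next \<X>)))) \<and>
     (\<forall>n. \<forall>\<phi>\<in>univ_part \<P>. sat N n a \<phi>) \<and>
     (\<forall>n. \<forall>d\<in>Dom N. \<forall>s\<in>step_part \<P>. sat N n (a(0 := d)) (step_fm s)) \<and>
     (\<forall>n. \<forall>d\<in>Dom N. \<forall>e\<in>evt_part \<P>. sat N n (a(0 := d)) (evt_fm e))"
proof -
  have fin: "finite (univ_part \<P>)" "finite (init_part \<P>)" "finite (step_part \<P>)"
    "finite (evt_part \<P>)" "finite \<X>"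
    using assms by (auto simp: monodic_problem_def extended_part_def)
  have copies: "sat N 0 a (conj_list (map (\<lambda>i. copy_fm cp i \<phi>) [0..<Suc k])) \<longleftrightarrow>
      (\<forall>i\<le>k. sat N 0 a (copy_fm cp i \<phi>))" for k \<phi>
    unfolding sat_conj_list by (auto simp: less_Suc_eq_le)
  show ?thesis
    by (subst sat_problem_fm)
      (use fin finite_language[OF assms] in
        \<open>simp_all add: reduction_def Let_def ball_Un copies conj_assoc del: upt_Suc\<close>)
qed

lemma sat_reduction_iff:
  fixes M N :: "('p, 'c, 'd) tstruct"
  assumes mp: "monodic_problem ar \<P>" and ep: "extended_part ar \<X>"
    and fc: "fresh_copies ar \<P> \<X> cp"
    and N: "temporal_structure ar N"
    and un: "unfolds (language \<P> \<X>) cp (max_next \<X>) M N"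
  shows "sat N 0 a (problem_fm (reduction ar cp \<P> \<X>)) \<longleftrightarrow> sat M 0 a (ext_problem_fm \<P> \<X>)"
proof -
  define k where "k = max_next \<X>"
  note un' = un[folded k_def]
  have D: "Dom N = Dom M" "Dom M \<noteq> {}"
    using un N by (auto simp: unfolds_def temporal_structure_def)
  have fin: "finite (univ_part \<P>)" "finite (init_part \<P>)" "finite (step_part \<P>)"
    "finite (evt_part \<P>)" "finite \<X>"
    using mp ep by (auto simp: monodic_problem_def extended_part_def)
  have fo: "first_order \<phi>" "set1_fm \<phi> \<subseteq> language \<P> \<X>"
    if "\<phi> \<in> univ_part \<P> \<union> init_part \<P>" for \<phi>
    using mp that by (auto simp: monodic_problem_def language_def)
  have step: "set1_fm (step_fm s :: ('p, 'c) fm) \<subseteq> language \<P> \<X>" if "s \<in> step_part \<P>" for s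
    using that by (auto simp: language_def)
  have evt: "set1_fm (evt_fm e :: ('p, 'c) fm) \<subseteq> language \<P> \<X>" if "e \<in> evt_part \<P>" for e
    using that by (auto simp: language_def)
  have "(\<forall>\<phi>\<in>init_part \<P>. sat N 0 a (copy_fm cp 0 \<phi>)) \<longleftrightarrow> (\<forall>\<phi>\<in>init_part \<P>. sat M 0 a \<phi>)"
    using fo by (simp add: sat_copy_fm[OF un'])
  moreover have "(\<forall>\<phi>\<in>univ_part \<P>. \<forall>i\<le>k. sat N 0 a (copy_fm cp i \<phi>)) \<and>
      (\<forall>n. \<forall>\<phi>\<in>univ_part \<P>. sat N n a \<phi>) \<longleftrightarrow> (\<forall>n. \<forall>\<phi>\<in>univ_part \<P>. sat M n a \<phi>)"
  proof -
    have "(\<forall>\<phi>\<in>univ_part \<P>. \<forall>i\<le>k. sat N 0 a (copy_fm cp i \<phi>)) \<longleftrightarrow>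
        (\<forall>i\<le>k. \<forall>\<phi>\<in>univ_part \<P>. sat M i a \<phi>)"
      using fo by (auto simp: sat_copy_fm[OF un'])
    moreover have "(\<forall>n. \<forall>\<phi>\<in>univ_part \<P>. sat N n a \<phi>) \<longleftrightarrow>
        (\<forall>n. \<forall>\<phi>\<in>univ_part \<P>. sat M (n + k) a \<phi>)"
      using fo by (simp add: sat_shift[OF un'])
    \<comment> \<open>Moment \<open>k\<close> is covered twice, by the copies with index
      \<open>k\<close> and by moment \<open>0\<close> of \<open>N\<close>; the split only asks for
      \<open>i < k\<close>.\<close>
    ultimately show ?thesis
      using all_nat_split[of "\<lambda>n. \<forall>\<phi>\<in>univ_part \<P>. sat M n a \<phi>" k] by (meson less_imp_le)
  qed
  moreover have "(\<forall>s\<in>step_part \<P>. sat N 0 a (step_copies cp k s)) \<and>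
      (\<forall>n. \<forall>d\<in>Dom N. \<forall>s\<in>step_part \<P>. sat N n (a(0 := d)) (step_fm s)) \<longleftrightarrow>
      (\<forall>n. \<forall>d\<in>Dom M. \<forall>s\<in>step_part \<P>. sat M n (a(0 := d)) (step_fm s))"
  proof -
    have "(\<forall>s\<in>step_part \<P>. sat N 0 a (step_copies cp k s)) \<longleftrightarrow>
        (\<forall>i<k. \<forall>d\<in>Dom M. \<forall>s\<in>step_part \<P>. sat M i (a(0 := d)) (step_fm s))"
      using step by (auto simp: sat_step_copies[OF un' _ D(2)])
    moreover have "(\<forall>n. \<forall>d\<in>Dom N. \<forall>s\<in>step_part \<P>. sat N n (a(0 := d)) (step_fm s)) \<longleftrightarrow>
        (\<forall>n. \<forall>d\<in>Dom M. \<forall>s\<in>step_part \<P>. sat M (n + k) (a(0 := d)) (step_fm s))"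
      using step by (simp add: D sat_step_fm_shift[OF un'])
    ultimately show ?thesis
      using all_nat_split[of "\<lambda>n. \<forall>d\<in>Dom M. \<forall>s\<in>step_part \<P>. sat M n (a(0 := d)) (step_fm s)" k]
      by simp
  qed
  moreover have "(\<forall>n. \<forall>d\<in>Dom N. \<forall>e\<in>evt_part \<P>. sat N n (a(0 := d)) (evt_fm e)) \<longleftrightarrow>
      (\<forall>n. \<forall>d\<in>Dom M. \<forall>e\<in>evt_part \<P>. sat M n (a(0 := d)) (evt_fm e))"
    (is "?evt_N \<longleftrightarrow> ?evt_M")
  proof -
    have "?evt_N \<longleftrightarrow> (\<forall>n. \<forall>d\<in>Dom M. \<forall>e\<in>evt_part \<P>. sat M (n + k) (a(0 := d)) (evt_fm e))"
      using evt by (simp add: D sat_evt_fm_shift[OF un'])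
    \<comment> \<open>Every moment \<open>n\<close> is at or before \<open>n + k\<close>, where the
      eventuality is known to hold.\<close>
    then show ?thesis
      using sat_evt_fm_antimono[OF _ le_add1] by blast
  qed
  moreover have "(\<forall>\<psi>\<in>\<X>. sat N 0 a (flatten cp 0 \<psi>)) \<longleftrightarrow> (\<forall>\<psi>\<in>\<X>. sat M 0 a \<psi>)"
  proof (rule ball_cong[OF refl])
    fix \<psi> assume \<psi>: "\<psi> \<in> \<X>"
    show "sat N 0 a (flatten cp 0 \<psi>) \<longleftrightarrow> sat M 0 a \<psi>"
    proof (rule sat_flatten)
      fix i P ts
      assume at: "tatom i P ts \<in> subfms \<psi>"
      have "P \<in> language \<P> \<X>"
        using set1_fm_subfms[OF at] \<psi> by (auto simp: set1_fm_tatom language_def)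
      moreover have "i \<le> k"
        unfolding k_def using fin(5) \<psi> at by (rule tatom_le_max_next)
      ultimately show "pint N 0 (cp P i) = pint M (0 + i) P"
        using un' by (simp add: unfolds_def)
    qed (use \<psi> ep un in \<open>auto simp: extended_part_def unfolds_def\<close>)
  qed
  \<comment> \<open>At moment \<open>0\<close> of \<open>N\<close> both \<open>P\<close> and
    \<open>cp P k\<close> are interpreted as \<open>P\<close> at moment \<open>k\<close> of
    \<open>M\<close>, so the equivalences hold outright.\<close>
  moreover have "\<forall>P\<in>language \<P> \<X>. sat N 0 a (pred_equiv ar P (cp P k))"
    using un' fc by (auto simp: k_def fresh_copies_def unfolds_def sat_pred_equiv[OF N])
  ultimately show ?thesis
    unfolding sat_problem_fm_reduction[OF mp ep] ext_problem_fm_def sat.simps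
      sat_problem_fm[OF fin(1-4)] sat_conj_set[OF fin(5)] k_def[symmetric]
    by argo
qed

section \<open>Construction of the related structures\<close>

text \<open>\<open>N\<close> starts at moment \<open>k\<close> of \<open>M\<close> and stores the
  moments up to \<open>k\<close> in the copies. Freshness makes this well defined: a copy lies
  outside the language and determines its predicate and index.\<close>

lemma ex_unfolds_reduction:
  fixes M :: "('p, 'c, 'd) tstruct"
  assumes fc: "fresh_copies ar \<P> \<X> cp" and M: "temporal_structure ar M"
  obtains N :: "('p, 'c, 'd) tstruct"
  where "temporal_structure ar N" "unfolds (language \<P> \<X>) cp (max_next \<X>) M N"
proof -
  define L k where "L = language \<P> \<X>" and "k = max_next \<X>"
  define f where "f = (\<lambda>(P, i). cp P i)"
  define g where "g = inv_into (L \<times> {..k}) f"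
  \<comment> \<open>A copy has the same interpretation at every moment of \<open>N\<close>, although
    \<open>unfolds\<close> constrains it at moment \<open>0\<close> only.\<close>
  define N :: "('p, 'c, 'd) tstruct" where
    "N = \<lparr> Dom = Dom M, cint = cint M,
       pint = (\<lambda>n P. if P \<in> L then pint M (n + k) P
                else if P \<in> f ` (L \<times> {..k}) then pint M (snd (g P)) (fst (g P)) else {}) \<rparr>"
  have g: "g (cp P i) = (P, i)" if "P \<in> L" "i \<le> k" for P i
    using fc that inv_into_f_f[of f "L \<times> {..k}" "(P, i)"]
    by (auto simp: fresh_copies_def g_def L_def k_def f_def)
  have new: "cp P i \<notin> L" "ar (cp P i) = ar P" "cp P i \<in> f ` (L \<times> {..k})"
    if "P \<in> L" "i \<le> k" for P i
    using fc that by (force simp: fresh_copies_def L_def k_def f_def)+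
  have M_pint: "ds \<in> pint M n P \<Longrightarrow> length ds = ar P \<and> set ds \<subseteq> Dom M" for ds n P
    using M unfolding temporal_structure_def by blast
  have "pint N n P \<subseteq> {ds. length ds = ar P \<and> set ds \<subseteq> Dom M}" for n P
    using M_pint by (fastforce simp: N_def f_def g new split: if_splits)
  then have "temporal_structure ar N"
    using M by (simp add: temporal_structure_def N_def)
  moreover have "unfolds L cp k M N"
    using new g by (simp add: unfolds_def N_def)
  ultimately show ?thesis
    using that by (simp add: L_def k_def)
qed

text \<open>\<open>M\<close> puts the moments stored in the copies before those of
  \<open>N\<close>.\<close>

lemma ex_reduction_unfolds:
  fixes N :: "('p, 'c, 'd) tstruct"
  assumes fc: "fresh_copies ar \<P> \<X> cp" and N: "temporal_structure ar N"
    and eq: "\<forall>P\<in>language \<P> \<X>. sat N 0 a (pred_equiv ar P (cp P (max_next \<X>)))"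
  obtains M :: "('p, 'c, 'd) tstruct"
  where "temporal_structure ar M" "unfolds (language \<P> \<X>) cp (max_next \<X>) M N"
proof -
  define L k where "L = language \<P> \<X>" and "k = max_next \<X>"
  \<comment> \<open>The arities of copies are fixed only for predicates of the language; making the
    others empty keeps \<open>M\<close> a temporal structure.\<close>
  define M :: "('p, 'c, 'd) tstruct" where
    "M = \<lparr> Dom = Dom N, cint = cint N,
       pint = (\<lambda>n P. if P \<notin> L then {} else if n \<le> k then pint N 0 (cp P n) else pint N (n - k) P) \<rparr>"
  have ar: "ar (cp P i) = ar P" if "P \<in> L" "i \<le> k" for P i
    using fc that by (simp add: fresh_copies_def L_def k_def)
  have N_pint: "ds \<in> pint N n P \<Longrightarrow> length ds = ar P \<and> set ds \<subseteq> Dom N" for ds n P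
    using N unfolding temporal_structure_def by blast
  have "pint M n P \<subseteq> {ds. length ds = ar P \<and> set ds \<subseteq> Dom N}" for n P
    using N_pint ar by (fastforce simp: M_def split: if_splits)
  then have "temporal_structure ar M"
    using N by (simp add: temporal_structure_def M_def)
  \<comment> \<open>\<open>M\<close> takes moment \<open>k\<close> from the copies, while
    \<open>unfolds\<close> asks for \<open>P\<close> at moment \<open>0\<close> of \<open>N\<close>;
    the equivalences close this gap.\<close>
  moreover have "pint N 0 P = pint N 0 (cp P k)" if "P \<in> L" for P
    using eq that sat_pred_equiv[OF N ar[of P k]] unfolding L_def k_def by blast
  then have "unfolds L cp k M N"
    by (simp add: unfolds_def M_def)
  ultimately show ?thesis
    using that by (simp add: L_def k_def)
qed

section \<open>Equisatisfiability of the extended problem and its reduction\<close>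

theorem theorem5:
  fixes ar :: "'p \<Rightarrow> nat"
    and \<P> :: "('p, 'c) problem"
    and \<X> :: "('p, 'c) fm set"
    and cp :: "'p \<Rightarrow> nat \<Rightarrow> 'p"
  assumes "monodic_problem ar \<P>"
    and "extended_part ar \<X>"
    and "fresh_copies ar \<P> \<X> cp"
  shows "satisfiable ar TYPE('d) (ext_problem_fm \<P> \<X>)
     \<longleftrightarrow> satisfiable ar TYPE('d) (problem_fm (reduction ar cp \<P> \<X>))"
proof
  assume "satisfiable ar TYPE('d) (ext_problem_fm \<P> \<X>)"
  then obtain M :: "('p, 'c, 'd) tstruct" and a
    where M: "temporal_structure ar M" "range a \<subseteq> Dom M" "sat M 0 a (ext_problem_fm \<P> \<X>)"
    by (auto simp: satisfiable_def)
  obtain N where N: "temporal_structure ar N" "unfolds (language \<P> \<X>) cp (max_next \<X>) M N"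
    using ex_unfolds_reduction[OF assms(3) M(1)] .
  have "range a \<subseteq> Dom N"
    using M(2) N(2) by (simp add: unfolds_def)
  with M N show "satisfiable ar TYPE('d) (problem_fm (reduction ar cp \<P> \<X>))"
    unfolding satisfiable_def using sat_reduction_iff[OF assms N] by blast
next
  assume "satisfiable ar TYPE('d) (problem_fm (reduction ar cp \<P> \<X>))"
  then obtain N :: "('p, 'c, 'd) tstruct" and a
    where N: "temporal_structure ar N" "range a \<subseteq> Dom N"
      "sat N 0 a (problem_fm (reduction ar cp \<P> \<X>))"
    by (auto simp: satisfiable_def)
  \<comment> \<open>The equivalences must be extracted from the initial part first, since the
    construction of \<open>M\<close> relies on them.\<close>
  have "\<forall>P\<in>language \<P> \<X>. sat N 0 a (pred_equiv ar P (cp P (max_next \<X>)))"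
    using N(3) unfolding sat_problem_fm_reduction[OF assms(1,2)] by blast
  then obtain M where M: "temporal_structure ar M" "unfolds (language \<P> \<X>) cp (max_next \<X>) M N"
    using ex_reduction_unfolds[OF assms(3) N(1)] by blast
  have "range a \<subseteq> Dom M"
    using N(2) M(2) by (simp add: unfolds_def)
  with M N show "satisfiable ar TYPE('d) (ext_problem_fm \<P> \<X>)"
    unfolding satisfiable_def using sat_reduction_iff[OF assms N(1) M(2)] by blast
qed

end
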